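(* For every integer $n\ge2$ and every integer $k\ge 0$, $$\left\langle {n\atop k}\right\rangle_B=\left\langle {n\atop k}\right\rangle_D+n2^{n-1}\left\langle {n-1\atop k-1}\right\rangle,$$ and, as an identity of polynomials in $t$, $$B_n(t)=D_n(t)+n2^{n-1}\,t\,S_{n-1}(t).$$
   Context: For $m\ge1$, $\left\langle {m\atop k}\right\rangle$ is the number of permutations $w=w_1\cdots w_m$ of $[m]=\{1,\dots,m\}$ with exactly $k$ descents, i.e. exactly $k$ indices $i\in\{1,\dots,m-1\}$ with $w_i>w_{i+1}$ (it is $0$ if $k<0$ or $k\ge m$); $S_m(t)=\sum_{k=0}^{m-1}\left\langle {m\atop k}\right\rangle t^k$. A signed permutation of $[n]$ is a permutation $u$ of $\{-n,\dots,-1,1,\dots,n\}$ with $u_{-i}=-u_i$ for all $i$. With the convention $u_0=0$, $\mathrm{des}_B(u)=|\{i\in\{0,1,\dots,n-1\}:u_i>u_{i+1}\}|$; $\left\langle {n\atop k}\right\rangle_B$ is the number of signed permutations $u$ of $[n]$ with $\mathrm{des}_B(u)=k$, and $B_n(t)=\sum_{k=0}^n\left\langle {n\atop k}\right\rangle_B t^k$. A signed permutation $u$ is even signed if the number of negative entries among $u_1,\dots,u_n$ is even. For even-signed $u$ (and $n\ge2$), $\mathrm{des}_D(u)=|\{i\in\{0,1,\dots,n-1\}:u_i>u_{i+1}\}|$ where now $u_0$ is set to be $-u_2$; $\left\langle {n\atop k}\right\rangle_D$ is the number of even-signed permutations $u$ of $[n]$ with $\mathrm{des}_D(u)=k$,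 and $D_n(t)=\sum_{k=0}^n\left\langle {n\atop k}\right\rangle_D t^k$. *)

theory Defs
  imports
    Complex_Main
    "HOL-Combinatorics.Permutations"
    "HOL-Computational_Algebra.Polynomial"
begin

definition des :: "nat \<Rightarrow> (nat \<Rightarrow> nat) \<Rightarrow> nat" where
  "des m w = card {i \<in> {1..<m}. w i > w (i + 1)}"

(* The second argument is an integer so that the value at k = -1 is available (it is 0). *)
definition eulerian :: "nat \<Rightarrow> int \<Rightarrow> nat" where
  "eulerian m k = card {w. w permutes {1..m} \<and> int (des m w) = k}"

definition eulerian_poly :: "nat \<Rightarrow> int poly" where
  "eulerian_poly m = (\<Sum>k<m. monom (int (eulerian m (int k))) k)"

definition signed_index :: "nat \<Rightarrow> int set" where
  "signed_index n = {- int n..int n} - {0}"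

definition signed_perms :: "nat \<Rightarrow> (int \<Rightarrow> int) set" where
  "signed_perms n =
     {u. u permutes signed_index n \<and> (\<forall>i \<in> signed_index n. u (- i) = - u i)}"

definition even_signed_perms :: "nat \<Rightarrow> (int \<Rightarrow> int) set" where
  "even_signed_perms n =
     {u \<in> signed_perms n. even (card {i \<in> {1..int n}. u i < 0})}"

definition des_B :: "nat \<Rightarrow> (int \<Rightarrow> int) \<Rightarrow> nat" where
  "des_B n u = (let v = u(0 := 0) in card {i \<in> {0..<int n}. v i > v (i + 1)})"

definition des_D :: "nat \<Rightarrow> (int \<Rightarrow> int) \<Rightarrow> nat" where
  "des_D n u = (let v = u(0 := - u 2) in card {i \<in> {0..<int n}. v i > v (i + 1)})"

definition eulerian_B :: "nat \<Rightarrow> nat \<Rightarrow> nat" where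
  "eulerian_B n k = card {u \<in> signed_perms n. des_B n u = k}"

definition eulerian_D :: "nat \<Rightarrow> nat \<Rightarrow> nat" where
  "eulerian_D n k = card {u \<in> even_signed_perms n. des_D n u = k}"

definition eulerian_poly_B :: "nat \<Rightarrow> int poly" where
  "eulerian_poly_B n = (\<Sum>k\<le>n. monom (int (eulerian_B n k)) k)"

definition eulerian_poly_D :: "nat \<Rightarrow> int poly" where
  "eulerian_poly_D n = (\<Sum>k\<le>n. monom (int (eulerian_D n k)) k)"

end

theory Submission
  imports Defs
begin

text \<open>
  Changing the sign of \<open>u\<^sub>1\<close> exchanges the type D descents at positions 0 and 1, hence preserves
  \<open>des\<^sub>D\<close>, and it changes the parity of the number of negative entries. So \<open>D\<^sub>n(t)\<close> is the
  descent sum over the signed permutations with \<open>u\<^sub>1 > 0\<close>. For such \<open>u\<close>, with \<open>u'\<close> obtained by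
  the sign change, comparing \<open>u\<^sub>2\<close> with \<open>\<plusminus> u\<^sub>1\<close> shows that the two numbers \<open>des\<^sub>B u\<close> and
  \<open>des\<^sub>B u'\<close> are, in some order, \<open>des\<^sub>D u\<close> and \<open>1 + d u\<close>, where \<open>d u\<close> counts the descents of the
  word \<open>u\<^sub>2 \<dots> u\<^sub>n\<close>. There are \<open>n 2\<^sup>n\<^sup>-\<^sup>1\<close> possible pairs consisting of \<open>u\<^sub>1 > 0\<close> and the set of
  values of this word, and for a given set the word is an arbitrary arrangement of it, so that
  \<open>d\<close> is distributed as the descent number on permutations of \<open>n - 1\<close> letters.
\<close>

section \<open>Signed permutations through their absolute values\<close>

text \<open>By oddness \<open>u\<close> is determined by its values at positive indices, and the
  absolute values there form an ordinary permutation. This gives a membership test that suits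
  functions built by hand.\<close>

lemma signed_perms_iff:
  "u \<in> signed_perms n \<longleftrightarrow>
     (\<forall>i. i \<notin> signed_index n \<longrightarrow> u i = i) \<and> (\<forall>i\<in>signed_index n. u (- i) = - u i) \<and>
     bij_betw (\<lambda>i. \<bar>u i\<bar>) {1..int n} {1..int n}"
  (is "_ \<longleftrightarrow> ?fix \<and> ?odd \<and> ?bij")
proof
  assume u: "u \<in> signed_perms n"
  then have p: "u permutes signed_index n" and odd: ?odd
    by (auto simp: signed_perms_def)
  have inj: "inj u" using p by (rule permutes_inj)
  have inS: "u i \<in> signed_index n" if "i \<in> signed_index n" for i
    using p that by (simp add: permutes_in_image)
  have "inj_on (\<lambda>i. \<bar>u i\<bar>) {1..int n}"
  proof (rule inj_onI)
    fix i j assume ij: "i \<in> {1..int n}" "j \<in> {1..int n}" "\<bar>u i\<bar> = \<bar>u j\<bar>"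
    \<comment> \<open>Oddness turns \<open>- u j\<close> into a value of \<open>u\<close>, so
      injectivity applies in both cases; the case \<open>i = - j\<close> then fails by
      positivity.\<close>
    then have "u i = u j \<or> u i = u (- j)"
      using odd by (auto simp: abs_eq_iff signed_index_def)
    then have "i = j \<or> i = - j" using inj by (auto dest: injD)
    then show "i = j" using ij by auto
  qed
  moreover have "(\<lambda>i. \<bar>u i\<bar>) ` {1..int n} \<subseteq> {1..int n}"
  proof safe
    fix i assume "i \<in> {1..int n}"
    then have "u i \<in> signed_index n" by (intro inS) (auto simp: signed_index_def)
    then show "\<bar>u i\<bar> \<in> {1..int n}" by (auto simp: signed_index_def)
  qed
  ultimately have ?bij
    unfolding bij_betw_def using endo_inj_surj[OF finite_atLeastAtMost_int] by blast
  then show "?fix \<and> ?odd \<and> ?bij" using p odd by (auto simp: permutes_not_in)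
next
  assume as: "?fix \<and> ?odd \<and> ?bij"
  have abs_u: "\<bar>u i\<bar> = \<bar>u \<bar>i\<bar>\<bar>" if "i \<in> signed_index n" for i
    using as that by (cases "i \<ge> 0") (auto simp: signed_index_def)
  have inS: "u i \<in> signed_index n" if i: "i \<in> signed_index n" for i
  proof -
    have "\<bar>i\<bar> \<in> {1..int n}" using i by (auto simp: signed_index_def)
    then have "\<bar>u \<bar>i\<bar>\<bar> \<in> {1..int n}" using as by (auto dest: bij_betwE)
    then show ?thesis using abs_u[OF i] by (auto simp: signed_index_def)
  qed
  have inj: "inj_on u (signed_index n)"
  proof (rule inj_onI)
    fix i j assume i: "i \<in> signed_index n" and j: "j \<in> signed_index n" and eq: "u i = u j"
    have "\<bar>i\<bar> \<in> {1..int n}" "\<bar>j\<bar> \<in> {1..int n}" using i j by (auto simp: signed_index_def)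
    moreover have "\<bar>u \<bar>i\<bar>\<bar> = \<bar>u \<bar>j\<bar>\<bar>" using abs_u[OF i] abs_u[OF j] eq by simp
    ultimately have "\<bar>i\<bar> = \<bar>j\<bar>" using as by (auto simp: bij_betw_def dest: inj_onD)
    \<comment> \<open>Otherwise \<open>u i = u j = - u i\<close>, which makes \<open>u i\<close>
      zero.\<close>
    moreover have "i \<noteq> - j"
    proof
      assume "i = - j"
      then have "u i = 0" using as i j eq by auto
      then show False using inS[OF i] by (simp add: signed_index_def)
    qed
    ultimately show "i = j" by (auto simp: abs_eq_iff)
  qed
  have "finite (signed_index n)" by (simp add: signed_index_def)
  then have "u ` signed_index n = signed_index n"
    using inS inj by (intro endo_inj_surj) auto
  then have "u permutes signed_index n"
    using as inj by (intro bij_imp_permutes) (auto simp: bij_betw_def)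
  then show "u \<in> signed_perms n" using as by (simp add: signed_perms_def)
qed

lemma finite_signed_perms: "finite (signed_perms n)"
  by (rule finite_subset[OF _ finite_permutations[of "signed_index n"]])
     (auto simp: signed_perms_def signed_index_def)

lemma signed_perms_abs_inj:
  assumes "u \<in> signed_perms n" "i \<in> {1..int n}" "j \<in> {1..int n}" "\<bar>u i\<bar> = \<bar>u j\<bar>"
  shows "i = j"
  using assms by (auto simp: signed_perms_iff bij_betw_def dest: inj_onD)

lemma signed_perms_nonzero:
  assumes "u \<in> signed_perms n" "i \<in> {1..int n}"
  shows "u i \<noteq> 0"
proof -
  have "\<bar>u i\<bar> \<in> {1..int n}" using assms by (auto simp: signed_perms_iff dest: bij_betwE)
  then show ?thesis by auto
qed

section \<open>Changing the sign of the first entry\<close>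

text \<open>The indices 1 and -1 are both treated, so that oddness survives.\<close>

definition flip_first :: "(int \<Rightarrow> int) \<Rightarrow> int \<Rightarrow> int" where
  "flip_first u = (\<lambda>i. if \<bar>i\<bar> = 1 then - u i else u i)"

definition tail_des :: "nat \<Rightarrow> (int \<Rightarrow> int) \<Rightarrow> nat" where
  "tail_des n u = card {i \<in> {2..<int n}. u i > u (i + 1)}"

lemma flip_first_flip_first [simp]: "flip_first (flip_first u) = u"
  by (auto simp: flip_first_def)

lemma flip_first_1 [simp]: "flip_first u 1 = - u 1"
  by (simp add: flip_first_def)

lemma flip_first_ge_2: "i \<ge> 2 \<Longrightarrow> flip_first u i = u i"
  by (simp add: flip_first_def)

lemma tail_des_flip_first [simp]: "tail_des n (flip_first u) = tail_des n u"
  unfolding tail_des_def by (rule arg_cong[of _ _ card]) (auto simp: flip_first_ge_2)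

lemma flip_first_in_signed_perms:
  assumes "n \<ge> 1" "u \<in> signed_perms n"
  shows "flip_first u \<in> signed_perms n"
proof -
  have "(\<lambda>i. \<bar>flip_first u i\<bar>) = (\<lambda>i. \<bar>u i\<bar>)" by (auto simp: flip_first_def)
  moreover have "\<bar>i\<bar> \<noteq> 1" if "i \<notin> signed_index n" for i
    using that assms(1) by (auto simp: signed_index_def)
  ultimately show ?thesis using assms(2)
    by (simp add: signed_perms_iff) (auto simp: flip_first_def)
qed

text \<open>As \<open>u 1\<close> is nonzero, the set of negative positions gains or loses exactly
  the position 1.\<close>

lemma even_flip_first:
  assumes "n \<ge> 1" "u \<in> signed_perms n"
  shows "even (card {i \<in> {1..int n}. flip_first u i < 0}) \<longleftrightarrow>
         odd (card {i \<in> {1..int n}. u i < 0})"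
proof -
  define R where "R = {i \<in> {2..int n}. u i < 0}"
  have "finite R" unfolding R_def by (rule finite_subset[of _ "{2..int n}"]) auto
  then have R: "finite R" "1 \<notin> R" by (auto simp: R_def)
  have "u 1 \<noteq> 0" using signed_perms_nonzero[OF assms(2), of 1] assms(1) by simp
  have split: "{1..int n} = insert 1 {2..int n}" using assms(1) by auto
  have "{i \<in> {1..int n}. u i < 0} = (if u 1 < 0 then insert 1 R else R)"
    by (auto simp: split R_def)
  moreover have "{i \<in> {1..int n}. flip_first u i < 0} = (if u 1 > 0 then insert 1 R else R)"
    by (auto simp: split R_def flip_first_ge_2)
  ultimately show ?thesis using R \<open>u 1 \<noteq> 0\<close> by auto
qed

section \<open>Descents of types B and D\<close>

text \<open>Serves both types at once: they differ only in the value that \<open>v\<close> is given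
  at 0.\<close>

lemma card_descents_from_0:
  fixes v :: "int \<Rightarrow> int"
  assumes "n \<ge> 2"
  shows "card {i \<in> {0..<int n}. v i > v (i + 1)} =
         of_bool (v 0 > v 1) + of_bool (v 1 > v 2) + tail_des n v"
proof -
  define R where "R = {i \<in> {2..<int n}. v i > v (i + 1)}"
  have "finite R" unfolding R_def by (rule finite_subset[of _ "{2..int n}"]) auto
  then have R: "finite R" "1 \<notin> R" "0 \<notin> R" by (auto simp: R_def)
  have split: "{0..<int n} = insert 0 (insert 1 {2..<int n})" using assms by auto
  have "{i \<in> {0..<int n}. v i > v (i + 1)} =
        (if v 0 > v 1 then {0} else {}) \<union> (if v 1 > v 2 then {1} else {}) \<union> R"
    unfolding split R_def by auto
  then show ?thesis using R unfolding tail_des_def R_def[symmetric] by auto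
qed

lemma tail_des_upd_0 [simp]: "tail_des n (u(0 := x)) = tail_des n u"
  unfolding tail_des_def by (rule arg_cong[of _ _ card]) auto

lemma des_B_eq:
  "n \<ge> 2 \<Longrightarrow> des_B n u = of_bool (u 1 < 0) + of_bool (u 1 > u 2) + tail_des n u"
  unfolding des_B_def Let_def by (subst card_descents_from_0) simp_all

lemma des_D_eq:
  "n \<ge> 2 \<Longrightarrow> des_D n u = of_bool (- u 2 > u 1) + of_bool (u 1 > u 2) + tail_des n u"
  unfolding des_D_def Let_def by (subst card_descents_from_0) simp_all

lemma des_D_flip_first:
  assumes "n \<ge> 2"
  shows "des_D n (flip_first u) = des_D n u"
  using assms by (auto simp: des_D_eq flip_first_ge_2 of_bool_def)

text \<open>For \<open>n \<ge> 1\<close> this picks one representative from each pair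
  \<open>u\<close>, \<open>flip_first u\<close> of signed permutations.\<close>

definition pos_perms :: "nat \<Rightarrow> (int \<Rightarrow> int) set" where
  "pos_perms n = {u \<in> signed_perms n. u 1 > 0}"

lemma finite_pos_perms: "finite (pos_perms n)"
  by (simp add: pos_perms_def finite_signed_perms)

text \<open>The first alternative holds when \<open>u 2 > - u 1\<close>, the second when
  \<open>u 2 < u 1\<close>; at least one of these is the case since \<open>u 1 > 0\<close>.\<close>

lemma des_B_flip_first_pair:
  assumes "n \<ge> 2" "u \<in> pos_perms n"
  shows "(des_B n u = des_D n u \<and> des_B n (flip_first u) = Suc (tail_des n u)) \<or>
         (des_B n (flip_first u) = des_D n u \<and> des_B n u = Suc (tail_des n u))"
proof -
  have u: "u \<in> signed_perms n" "u 1 > 0" using assms(2) by (auto simp: pos_perms_def)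
  have "\<bar>u 1\<bar> \<noteq> \<bar>u 2\<bar>" using signed_perms_abs_inj[OF u(1), of 1 2] assms(1) by auto
  then show ?thesis using u(2) assms(1)
    by (auto simp: des_B_eq des_D_eq flip_first_ge_2 of_bool_def)
qed

section \<open>Reduction to signed permutations with positive first entry\<close>

lemma card_conj_split:
  assumes "finite A"
  shows "card {x \<in> A. P x} = card {x \<in> A. P x \<and> Q x} + card {x \<in> A. P x \<and> \<not> Q x}"
proof -
  have "{x \<in> A. P x} = {x \<in> A. P x \<and> Q x} \<union> {x \<in> A. P x \<and> \<not> Q x}" by auto
  then show ?thesis using assms by (simp add: card_Un_disjoint disjoint_iff)
qed

lemma eulerian_D_pos_perms:
  assumes n: "n \<ge> 2"
  shows "eulerian_D n k = card {u \<in> pos_perms n. des_D n u = k}"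
proof -
  define ev where "ev u = even (card {i \<in> {1..int n}. u i < 0})" for u :: "int \<Rightarrow> int"
  let ?S = "signed_perms n"
  have ev_flip: "ev (flip_first u) \<longleftrightarrow> \<not> ev u" if "u \<in> ?S" for u
    unfolding ev_def using even_flip_first[of n u] that n by simp
  \<comment> \<open>Even-signed \<open>u\<close> with \<open>u 1 > 0\<close> occur in both counts,
    so only the remaining elements have to be matched.\<close>
  have "bij_betw flip_first {u \<in> ?S. (ev u \<and> des_D n u = k) \<and> \<not> u 1 > 0}
                            {u \<in> ?S. (u 1 > 0 \<and> des_D n u = k) \<and> \<not> ev u}"
  proof (rule bij_betw_byWitness[where f' = flip_first])
    show "flip_first ` {u \<in> ?S. (ev u \<and> des_D n u = k) \<and> \<not> u 1 > 0}
            \<subseteq> {u \<in> ?S. (u 1 > 0 \<and> des_D n u = k) \<and> \<not> ev u}"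
    proof safe
      fix u assume "u \<in> ?S" "\<not> u 1 > 0"
      then show "flip_first u 1 > 0" using signed_perms_nonzero[of u n 1] n by auto
    qed (use n in \<open>auto simp: flip_first_in_signed_perms des_D_flip_first ev_flip\<close>)
    show "flip_first ` {u \<in> ?S. (u 1 > 0 \<and> des_D n u = k) \<and> \<not> ev u}
            \<subseteq> {u \<in> ?S. (ev u \<and> des_D n u = k) \<and> \<not> u 1 > 0}"
      using n by (auto simp: flip_first_in_signed_perms des_D_flip_first ev_flip)
  qed auto
  from bij_betw_same_card[OF this]
  have "card {u \<in> ?S. ev u \<and> des_D n u = k} = card {u \<in> ?S. u 1 > 0 \<and> des_D n u = k}"
    using card_conj_split[OF finite_signed_perms, of n "\<lambda>u. ev u \<and> des_D n u = k" "\<lambda>u. u 1 > 0"]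
      card_conj_split[OF finite_signed_perms, of n "\<lambda>u. u 1 > 0 \<and> des_D n u = k" ev]
    by (simp add: conj_commute conj_left_commute)
  then show ?thesis
    by (simp add: eulerian_D_def even_signed_perms_def pos_perms_def ev_def)
qed

text \<open>Those \<open>u\<close> with \<open>u 1 < 0\<close> are exactly the sign changes of those
  with \<open>u 1 > 0\<close>.\<close>

lemma eulerian_B_pos_perms:
  assumes n: "n \<ge> 2"
  shows "eulerian_B n k = card {u \<in> pos_perms n. des_B n u = k}
                        + card {u \<in> pos_perms n. des_B n (flip_first u) = k}"
proof -
  let ?S = "signed_perms n"
  have "bij_betw flip_first {u \<in> ?S. des_B n u = k \<and> \<not> u 1 > 0}
                            {u \<in> pos_perms n. des_B n (flip_first u) = k}"
  proof (rule bij_betw_byWitness[where f' = flip_first])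
    show "flip_first ` {u \<in> ?S. des_B n u = k \<and> \<not> u 1 > 0}
            \<subseteq> {u \<in> pos_perms n. des_B n (flip_first u) = k}"
    proof safe
      fix u assume u: "u \<in> ?S" "\<not> u 1 > 0"
      then have "u 1 \<noteq> 0" using signed_perms_nonzero[of u n 1] n by auto
      then show "flip_first u \<in> pos_perms n"
        using u n by (simp add: pos_perms_def flip_first_in_signed_perms)
    qed auto
    show "flip_first ` {u \<in> pos_perms n. des_B n (flip_first u) = k}
            \<subseteq> {u \<in> ?S. des_B n u = k \<and> \<not> u 1 > 0}"
      using n by (auto simp: pos_perms_def flip_first_in_signed_perms)
  qed auto
  from bij_betw_same_card[OF this] show ?thesis
    using card_conj_split[OF finite_signed_perms, of n "\<lambda>u. des_B n u = k" "\<lambda>u. u 1 > 0"]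
    by (simp add: eulerian_B_def pos_perms_def conj_commute conj_left_commute)
qed

text \<open>The two type B descent numbers of a pair are known only up to order, but a sum of two
  indicators is symmetric, so the identity holds pair by pair.\<close>

lemma eulerian_B_eq_D_plus_tail:
  assumes n: "n \<ge> 2"
  shows "eulerian_B n k = eulerian_D n k + card {u \<in> pos_perms n. Suc (tail_des n u) = k}"
proof -
  have card_eq: "card {u \<in> pos_perms n. P u} = (\<Sum>u\<in>pos_perms n. of_bool (P u))"
    for P :: "(int \<Rightarrow> int) \<Rightarrow> bool"
    using finite_pos_perms by (simp add: Int_def)
  have "of_bool (des_B n u = k) + of_bool (des_B n (flip_first u) = k) =
        of_bool (des_D n u = k) + (of_bool (Suc (tail_des n u) = k) :: nat)"
    if "u \<in> pos_perms n" for u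
  proof -
    have swap: "of_bool (x = k) + of_bool (y = k) = of_bool (a = k) + (of_bool (b = k) :: nat)"
      if "(x = a \<and> y = b) \<or> (y = a \<and> x = b)" for x y a b :: nat
      using that by (auto simp: add.commute)
    show ?thesis by (rule swap[OF des_B_flip_first_pair[OF n that]])
  qed
  then have "(\<Sum>u\<in>pos_perms n. of_bool (des_B n u = k) + of_bool (des_B n (flip_first u) = k)) =
        (\<Sum>u\<in>pos_perms n. of_bool (des_D n u = k) + (of_bool (Suc (tail_des n u) = k) :: nat))"
    by (intro sum.cong refl)
  then show ?thesis
    by (simp only: eulerian_B_pos_perms[OF n] eulerian_D_pos_perms[OF n] card_eq sum.distrib)
qed

text \<open>Order-preserving relabelling of the letters of the word \<open>u\<^sub>2 \<dots> u\<^sub>n\<close> by \<open>1, \<dots>, n - 1\<close>.\<close>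

lemma card_tail_fibre:
  assumes n: "n \<ge> 2" and a: "a \<in> {1..int n}"
    and inj: "inj_on abs A" and abs_A: "abs ` A = {1..int n} - {a}"
  shows "card {u \<in> pos_perms n. (u 1 = a \<and> u ` {2..int n} = A) \<and> Suc (tail_des n u) = k} =
         eulerian (n - 1) (int k - 1)"
proof -
  define m where "m = n - 1"
  have nm: "int n = int m + 1" using n by (simp add: m_def)
  have finA: "finite A" using inj abs_A by (metis finite_Diff finite_atLeastAtMost_int finite_imageD)
  have cardA: "card A = m"
    using card_image[OF inj] abs_A a by (simp add: m_def)
  \<comment> \<open>The increasing enumeration of \<open>A\<close>, indexed from 1 while list
    positions start at 0.\<close>
  define e where "e i = sorted_list_of_set A ! (i - 1)" for i
  have sl: "sorted_wrt (<) (sorted_list_of_set A)" "length (sorted_list_of_set A) = m"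
    "set (sorted_list_of_set A) = A" "distinct (sorted_list_of_set A)"
    using finA cardA by auto
  have e_mono: "e i < e j" if "i \<in> {1..m}" "j \<in> {1..m}" "i < j" for i j
  proof -
    have "i - 1 < j - 1" "j - 1 < length (sorted_list_of_set A)" using that sl(2) by auto
    then show ?thesis unfolding e_def by (rule sorted_wrt_nth_less[OF sl(1)])
  qed
  have e_less: "e i < e j \<longleftrightarrow> i < j" if "i \<in> {1..m}" "j \<in> {1..m}" for i j
    using e_mono that by (metis linorder_neqE_nat order_less_asym)
  have bij_e: "bij_betw e {1..m} A"
  proof -
    have "bij_betw (\<lambda>i. i - 1) {1..m} {..<m}"
      by (rule bij_betw_byWitness[where f' = Suc]) auto
    moreover have "bij_betw ((!) (sorted_list_of_set A)) {..<m} A"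
      using sl by (intro bij_betw_nth) auto
    ultimately have "bij_betw ((!) (sorted_list_of_set A) \<circ> (\<lambda>i. i - 1)) {1..m} A"
      by (rule bij_betw_trans)
    then show ?thesis by (simp add: e_def[abs_def] comp_def)
  qed
  have bij_shift: "bij_betw (\<lambda>i. nat i - 1) {2..int n} {1..m}"
    using nm by (intro bij_betw_byWitness[where f' = "\<lambda>j. int j + 1"]) auto
  \<comment> \<open>First entry \<open>a\<close>, then the word \<open>w\<close> spelled in the
    letters of \<open>A\<close>: letter \<open>j\<close> of \<open>w\<close> goes to position
    \<open>j + 1\<close>. The factor \<open>sgn i\<close> makes the extension odd.\<close>
  define ext :: "(nat \<Rightarrow> nat) \<Rightarrow> int \<Rightarrow> int" where
    "ext w = (\<lambda>i. if i \<in> signed_index n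
       then sgn i * (if \<bar>i\<bar> = 1 then a else e (w (nat \<bar>i\<bar> - 1))) else i)" for w
  \<comment> \<open>The inverse of \<open>ext\<close> on \<open>F\<close>; the value
    \<open>j\<close> outside \<open>{1..m}\<close> is what \<open>permutes\<close> demands.\<close>
  define res :: "(int \<Rightarrow> int) \<Rightarrow> nat \<Rightarrow> nat" where
    "res u = (\<lambda>j. if j \<in> {1..m} then inv_into {1..m} e (u (int j + 1)) else j)" for u
  define F where "F = {u \<in> pos_perms n. u 1 = a \<and> u ` {2..int n} = A}"
  have ext_1: "ext w 1 = a" for w using n by (simp add: ext_def signed_index_def)
  have ext_ge_2: "ext w i = e (w (nat i - 1))" if "i \<in> {2..int n}" for w i
    using that by (simp add: ext_def signed_index_def)
  have ext_F: "ext w \<in> F" if w: "w permutes {1..m}" for w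
  proof -
    have "bij_betw (e \<circ> (w \<circ> (\<lambda>i. nat i - 1))) {2..int n} A"
      by (rule bij_betw_trans[OF bij_betw_trans[OF bij_shift permutes_imp_bij[OF w]] bij_e])
    then have bij: "bij_betw (ext w) {2..int n} A"
      by (rule bij_betw_cong[THEN iffD1, rotated]) (simp add: ext_ge_2)
    \<comment> \<open>The tail covers every absolute value except \<open>a\<close>, and position 1
      supplies that one, so the criterion \<open>signed_perms_iff\<close> applies.\<close>
    have "bij_betw abs A ({1..int n} - {a})" using inj abs_A by (simp add: bij_betw_def)
    from bij_betw_trans[OF bij this]
    have "bij_betw (\<lambda>i. \<bar>ext w i\<bar>) {2..int n} ({1..int n} - {a})" by (simp add: comp_def)
    moreover have "bij_betw (\<lambda>i. \<bar>ext w i\<bar>) {1} {a}" using a by (simp add: ext_1)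
    ultimately have "bij_betw (\<lambda>i. \<bar>ext w i\<bar>) ({1} \<union> {2..int n}) ({a} \<union> ({1..int n} - {a}))"
      by (intro bij_betw_combine) auto
    moreover have "{1} \<union> {2..int n} = {1..int n}" "{a} \<union> ({1..int n} - {a}) = {1..int n}"
      using n a by auto
    ultimately have "bij_betw (\<lambda>i. \<bar>ext w i\<bar>) {1..int n} {1..int n}" by simp
    then have "ext w \<in> signed_perms n"
      by (simp add: signed_perms_iff) (auto simp: ext_def signed_index_def)
    then show ?thesis using a bij by (simp add: F_def pos_perms_def ext_1 bij_betw_def)
  qed
  have bij_F: "bij_betw u {2..int n} A" if "u \<in> F" for u
  proof -
    have sp: "u \<in> signed_perms n" and img: "u ` {2..int n} = A"
      using that by (auto simp: F_def pos_perms_def)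
    have "inj_on u {2..int n}"
    proof (rule inj_onI)
      fix i j assume "i \<in> {2..int n}" "j \<in> {2..int n}" "u i = u j"
      then show "i = j" using signed_perms_abs_inj[OF sp, of i j] by simp
    qed
    then show ?thesis using img by (simp add: bij_betw_def)
  qed
  have res_permutes: "res u permutes {1..m}" if u: "u \<in> F" for u
  proof (rule bij_imp_permutes)
    have "bij_betw (\<lambda>j. int j + 1) {1..m} {2..int n}"
      using nm by (intro bij_betw_byWitness[where f' = "\<lambda>i. nat i - 1"]) auto
    from bij_betw_trans[OF bij_betw_trans[OF this bij_F[OF u]] bij_betw_inv_into[OF bij_e]]
    have "bij_betw (inv_into {1..m} e \<circ> (u \<circ> (\<lambda>j. int j + 1))) {1..m} {1..m}" .
    then show "bij_betw (res u) {1..m} {1..m}"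
      by (rule bij_betw_cong[THEN iffD1, rotated]) (simp add: res_def)
  qed (auto simp: res_def)
  have res_ext: "res (ext w) = w" if w: "w permutes {1..m}" for w
  proof
    fix j show "res (ext w) j = w j"
    proof (cases "j \<in> {1..m}")
      case True
      then have "ext w (int j + 1) = e (w j)" using nm by (simp add: ext_ge_2 nat_add_distrib)
      moreover have "w j \<in> {1..m}" using w True by (simp only: permutes_in_image)
      ultimately show ?thesis using True bij_e by (simp add: res_def bij_betw_inv_into_left)
    next
      case False
      then show ?thesis using permutes_not_in[OF w False] by (simp only: res_def if_False)
    qed
  qed
  have ext_res: "ext (res u) = u" if u: "u \<in> F" for u
  proof
    have sp: "u \<in> signed_perms n" and u1: "u 1 = a" using u by (auto simp: F_def pos_perms_def)
    have pos: "ext (res u) i = u i" if i: "i \<in> {1..int n}" for i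
    proof (cases "i = 1")
      case False
      then have i2: "i \<in> {2..int n}" using i by auto
      then have "u i \<in> e ` {1..m}" using bij_F[OF u] bij_e by (auto simp: bij_betw_def)
      then have "e (inv_into {1..m} e (u i)) = u i" by (rule f_inv_into_f)
      moreover have "nat i - 1 \<in> {1..m}" "int (nat i - 1) + 1 = i" using i2 nm by auto
      ultimately show ?thesis using i2 by (simp add: ext_ge_2 res_def)
    qed (simp add: u1 ext_1)
    have odd: "v (- i) = - v i" if "v \<in> signed_perms n" "i \<in> signed_index n" for v i
      using that by (simp add: signed_perms_iff)
    have ext_sp: "ext (res u) \<in> signed_perms n"
      using ext_F[OF res_permutes[OF u]] by (simp add: F_def pos_perms_def)
    fix i
    \<comment> \<open>Agreement at positive indices spreads to negative ones by oddness; elsewhere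
      both functions are the identity.\<close>
    consider "i \<in> {1..int n}" | "i \<in> signed_index n" "- i \<in> {1..int n}" | "i \<notin> signed_index n"
      by (force simp: signed_index_def)
    then show "ext (res u) i = u i"
    proof cases
      case 2
      then show ?thesis using odd[OF sp] odd[OF ext_sp] pos[of "- i"] by simp
    next
      case 3
      then show ?thesis using sp ext_sp by (simp add: signed_perms_iff)
    qed (rule pos)
  qed
  have tail_des_ext: "tail_des n (ext w) = des m w" if w: "w permutes {1..m}" for w
  proof -
    \<comment> \<open>Since \<open>e\<close> is increasing, relabelling preserves comparisons; only
      the shift of positions by one remains.\<close>
    have eq: "ext w i > ext w (i + 1) \<longleftrightarrow> w (nat i - 1) > w (nat i - 1 + 1)"
      if i: "i \<in> {2..<int n}" for i
    proof -
      have "nat (i + 1) - 1 = nat i - 1 + 1" using i by auto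
      moreover have "nat i - 1 \<in> {1..m}" "nat i - 1 + 1 \<in> {1..m}" using i nm by auto
      then have "w (nat i - 1) \<in> {1..m}" "w (nat i - 1 + 1) \<in> {1..m}"
        using w by (simp_all only: permutes_in_image)
      ultimately show ?thesis using i e_less by (simp add: ext_ge_2)
    qed
    have "bij_betw (\<lambda>i. nat i - 1) {i \<in> {2..<int n}. ext w i > ext w (i + 1)}
            {j \<in> {1..<m}. w j > w (j + 1)}"
    proof (rule bij_betw_byWitness[where f' = "\<lambda>j. int j + 1"])
      show "(\<lambda>i. nat i - 1) ` {i \<in> {2..<int n}. ext w i > ext w (i + 1)}
              \<subseteq> {j \<in> {1..<m}. w j > w (j + 1)}"
      proof safe
        fix i assume "i \<in> {2..<int n}" "ext w i > ext w (i + 1)"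
        then show "nat i - 1 \<in> {1..<m}" "w (nat i - 1) > w (nat i - 1 + 1)"
          using nm eq by auto
      qed
      show "(\<lambda>j. int j + 1) ` {j \<in> {1..<m}. w j > w (j + 1)}
              \<subseteq> {i \<in> {2..<int n}. ext w i > ext w (i + 1)}"
      proof safe
        fix j assume j: "j \<in> {1..<m}" "w j > w (j + 1)"
        then show "int j + 1 \<in> {2..<int n}" using nm by auto
        then show "ext w (int j + 1) > ext w (int j + 1 + 1)" using eq[of "int j + 1"] j by (simp add: nat_add_distrib)
      qed
    qed auto
    then show ?thesis unfolding tail_des_def des_def by (rule bij_betw_same_card)
  qed
  \<comment> \<open>For \<open>k = 0\<close> both sets are empty, in line with the integer value
    \<open>int k - 1 = -1\<close>.\<close>
  have "bij_betw ext {w. w permutes {1..m} \<and> int (des m w) = int k - 1}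
          {u \<in> F. Suc (tail_des n u) = k}"
  proof (rule bij_betw_byWitness[where f' = res])
    show "res ` {u \<in> F. Suc (tail_des n u) = k}
            \<subseteq> {w. w permutes {1..m} \<and> int (des m w) = int k - 1}"
    proof safe
      fix u assume u: "u \<in> F"
      show "res u permutes {1..m}" using u by (rule res_permutes)
      then show "int (des m (res u)) = int (Suc (tail_des n u)) - 1"
        using tail_des_ext[of "res u"] ext_res[OF u] by simp
    qed
  qed (auto simp: res_ext ext_res ext_F tail_des_ext)
  from bij_betw_same_card[OF this] show ?thesis
    by (simp add: eulerian_def F_def m_def)
qed

section \<open>Summation over first entries and value sets\<close>

lemma card_tail:
  assumes n: "n \<ge> 2"
  shows "card {u \<in> pos_perms n. Suc (tail_des n u) = k} =
         n * 2 ^ (n - 1) * eulerian (n - 1) (int k - 1)"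
proof -
  \<comment> \<open>A value set is encoded by the set \<open>N\<close> of absolute values carrying a
    minus sign; \<open>vals\<close> decodes it, choosing one of \<open>x\<close>, \<open>- x\<close>
    for each \<open>x \<noteq> a\<close>.\<close>
  define I where "I = (SIGMA a:{1..int n}. Pow ({1..int n} - {a}))"
  define vals where "vals = (\<lambda>(a, N). {x. \<bar>x\<bar> \<in> {1..int n} - {a} \<and> (x < 0 \<longleftrightarrow> \<bar>x\<bar> \<in> N)})"
  define fib where "fib p = {u \<in> pos_perms n. (u 1 = fst p \<and> u ` {2..int n} = vals p)
    \<and> Suc (tail_des n u) = k}" for p
  have finI: "finite I" by (simp add: I_def)
  have card_I: "card I = n * 2 ^ (n - 1)" by (simp add: I_def card_Pow)
  have card_fib: "card (fib p) = eulerian (n - 1) (int k - 1)" if p: "p \<in> I" for p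
  proof -
    have a: "fst p \<in> {1..int n}" using p by (auto simp: I_def)
    have "inj_on abs (vals p)"
      by (rule inj_onI) (auto simp: vals_def abs_eq_iff split: prod.splits)
    moreover have "abs ` vals p = {1..int n} - {fst p}"
    proof
      show "{1..int n} - {fst p} \<subseteq> abs ` vals p"
      proof
        fix x assume x: "x \<in> {1..int n} - {fst p}"
        show "x \<in> abs ` vals p"
          \<comment> \<open>The witness is the signed representative of \<open>x\<close> prescribed
            by \<open>N = snd p\<close>.\<close>
          using x by (intro image_eqI[of _ _ "if x \<in> snd p then - x else x"])
                     (auto simp: vals_def split: prod.splits)
      qed
    qed (auto simp: vals_def split: prod.splits)
    ultimately show ?thesis unfolding fib_def using card_tail_fibre[OF n a] by blast
  qed
  have vals_inj: "N = M" if "(a, N) \<in> I" "(a, M) \<in> I" "vals (a, N) = vals (a, M)" for a N M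
  proof -
    \<comment> \<open>The sign set is recovered from the values, which later makes the fibres
      disjoint.\<close>
    have "L = {x \<in> {1..int n}. - x \<in> vals (a, L)}" if "(a, L) \<in> I" for L
      using that by (auto simp: I_def vals_def)
    then show ?thesis using that by blast
  qed
  have "{u \<in> pos_perms n. Suc (tail_des n u) = k} = (\<Union>p\<in>I. fib p)"
  proof safe
    fix u assume u: "u \<in> pos_perms n" and k: "k = Suc (tail_des n u)"
    have sp: "u \<in> signed_perms n" and u1: "u 1 > 0" using u by (auto simp: pos_perms_def)
    have bij: "bij_betw (\<lambda>i. \<bar>u i\<bar>) {1..int n} {1..int n}" using sp by (simp add: signed_perms_iff)
    define N where "N = {x \<in> {1..int n}. - x \<in> u ` {2..int n}}"
    have ne: "\<bar>u i\<bar> \<noteq> u 1" if "i \<in> {2..int n}" for i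
      using signed_perms_abs_inj[OF sp, of i 1] that u1 by auto
    have rng: "\<bar>u i\<bar> \<in> {1..int n}" if "i \<in> {1..int n}" for i
      using bij that by (auto dest: bij_betwE)
    have "(u 1, N) \<in> I"
    proof -
      have "u 1 \<in> {1..int n}" using rng[of 1] u1 n by auto
      moreover have "u 1 \<notin> N"
      proof
        assume "u 1 \<in> N"
        then obtain i where "i \<in> {2..int n}" "- u 1 = u i" by (auto simp: N_def)
        then show False using ne[of i] u1 by auto
      qed
      ultimately show ?thesis by (auto simp: I_def N_def)
    qed
    moreover have "u ` {2..int n} = vals (u 1, N)"
    proof
      show "u ` {2..int n} \<subseteq> vals (u 1, N)"
      proof
        fix y assume "y \<in> u ` {2..int n}"
        then obtain i where i: "i \<in> {2..int n}" "y = u i" by auto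
        have "\<bar>y\<bar> \<in> {1..int n} - {u 1}" using rng[of i] ne[of i] i by auto
        moreover have "y < 0 \<longleftrightarrow> \<bar>y\<bar> \<in> N"
        proof
          assume "y < 0"
          then have "- \<bar>y\<bar> = u i" using i by simp
          then show "\<bar>y\<bar> \<in> N" using i rng[of i] by (auto simp: N_def)
        next
          assume "\<bar>y\<bar> \<in> N"
          then obtain j where j: "j \<in> {2..int n}" "- \<bar>y\<bar> = u j" by (auto simp: N_def)
          then have "\<bar>u i\<bar> = \<bar>u j\<bar>" using i by simp
          \<comment> \<open>An absolute value occurs at one position only, so \<open>y\<close>
            itself equals \<open>- \<bar>y\<bar>\<close>.\<close>
          then have "i = j" using signed_perms_abs_inj[OF sp, of i j] i j by auto
          then show "y < 0" using i j signed_perms_nonzero[OF sp, of i] by auto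
        qed
        ultimately show "y \<in> vals (u 1, N)" by (simp add: vals_def)
      qed
      show "vals (u 1, N) \<subseteq> u ` {2..int n}"
      proof
        fix x assume "x \<in> vals (u 1, N)"
        then have x: "\<bar>x\<bar> \<in> {1..int n}" "\<bar>x\<bar> \<noteq> u 1" "x < 0 \<longleftrightarrow> \<bar>x\<bar> \<in> N"
          by (auto simp: vals_def)
        then have "\<bar>x\<bar> \<in> (\<lambda>i. \<bar>u i\<bar>) ` {1..int n}" using bij_betw_imp_surj_on[OF bij] by blast
        then obtain i where i: "i \<in> {1..int n}" "\<bar>u i\<bar> = \<bar>x\<bar>" by auto
        moreover have "i \<noteq> 1" using i x u1 by auto
        ultimately have i2: "i \<in> {2..int n}" by auto
        show "x \<in> u ` {2..int n}"
        proof (cases "x < 0")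
          case True
          then show ?thesis using x by (auto simp: N_def)
        next
          case False
          \<comment> \<open>Here \<open>\<bar>x\<bar>\<close> is outside \<open>N\<close>, so the
            entry with this absolute value must be \<open>x\<close> rather than
            \<open>- x\<close>.\<close>
          then have "- x \<notin> u ` {2..int n}" using x by (auto simp: N_def)
          then have "u i \<noteq> - x" using imageI[OF i2, of u] by metis
          then have "u i = x" using i(2) by (simp add: abs_eq_iff)
          then show ?thesis using i2 by auto
        qed
      qed
    qed
    ultimately have "u \<in> fib (u 1, N)" "(u 1, N) \<in> I" using u k by (simp_all add: fib_def)
    then show "u \<in> (\<Union>p\<in>I. fib p)" by blast
  qed (auto simp: fib_def)
  also have "card \<dots> = (\<Sum>p\<in>I. card (fib p))"
  proof (rule card_UN_disjoint[OF finI])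
    show "\<forall>p\<in>I. finite (fib p)" by (simp add: fib_def finite_pos_perms)
    have "p = q" if "p \<in> I" "q \<in> I" "u \<in> fib p" "u \<in> fib q" for p q u
      using that vals_inj by (cases p; cases q) (auto simp: fib_def)
    then show "\<forall>p\<in>I. \<forall>q\<in>I. p \<noteq> q \<longrightarrow> fib p \<inter> fib q = {}" by blast
  qed
  also have "\<dots> = n * 2 ^ (n - 1) * eulerian (n - 1) (int k - 1)"
    by (simp add: card_fib card_I)
  finally show ?thesis .
qed

section \<open>From numbers to polynomials\<close>

text \<open>There are at most \<open>m - 1\<close> descents. For \<open>m = 0\<close> the empty
  permutation would give the value 1 at \<open>k = 0\<close>.\<close>

lemma eulerian_eq_0:
  assumes "m \<ge> 1" "k < 0 \<or> k \<ge> int m"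
  shows "eulerian m k = 0"
proof -
  have "des m w < m" for w
  proof -
    have "des m w \<le> card {1..<m}" unfolding des_def by (intro card_mono) auto
    then show ?thesis using assms(1) by simp
  qed
  then have "{w. w permutes {1..m} \<and> int (des m w) = k} = {}" using assms(2) by (metis (mono_tags, lifting) Collect_empty_eq not_less of_nat_0_le_iff of_nat_less_iff)
  then show ?thesis by (simp only: eulerian_def card.empty)
qed

lemma coeff_X_mult_eulerian_poly:
  assumes "m \<ge> 1"
  shows "coeff (monom 1 1 * eulerian_poly m) k = int (eulerian m (int k - 1))"
proof (cases k)
  case 0
  then show ?thesis using assms by (simp add: coeff_monom_mult eulerian_eq_0)
next
  case (Suc j)
  \<comment> \<open>The truncation at \<open>k < m\<close> in the polynomial loses only zero
    coefficients.\<close>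
  have "coeff (eulerian_poly m) j = int (eulerian m (int j))"
    using assms eulerian_eq_0[of m "int j"]
    by (auto simp: eulerian_poly_def coeff_sum)
  then show ?thesis using Suc by (simp add: coeff_monom_mult)
qed

theorem mainTheorem3:
  fixes n :: nat
  assumes "n \<ge> 2"
  shows "(\<forall>k::nat. eulerian_B n k
            = eulerian_D n k + n * 2 ^ (n - 1) * eulerian (n - 1) (int k - 1))
       \<and> eulerian_poly_B n
            = eulerian_poly_D n
              + smult (int n * 2 ^ (n - 1)) (monom 1 1 * eulerian_poly (n - 1))"
proof
  have eq: "eulerian_B n k = eulerian_D n k + n * 2 ^ (n - 1) * eulerian (n - 1) (int k - 1)" for k
    using eulerian_B_eq_D_plus_tail[OF assms] card_tail[OF assms] by simp
  then show "\<forall>k::nat. eulerian_B n k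
            = eulerian_D n k + n * 2 ^ (n - 1) * eulerian (n - 1) (int k - 1)" by blast
  show "eulerian_poly_B n = eulerian_poly_D n
              + smult (int n * 2 ^ (n - 1)) (monom 1 1 * eulerian_poly (n - 1))"
  proof (rule poly_eqI)
    fix k
    have "coeff (eulerian_poly_B n) k = (if k \<le> n then int (eulerian_B n k) else 0)"
      by (auto simp: eulerian_poly_B_def coeff_sum)
    moreover have "coeff (eulerian_poly_D n) k = (if k \<le> n then int (eulerian_D n k) else 0)"
      by (auto simp: eulerian_poly_D_def coeff_sum)
    moreover have "coeff (monom 1 1 * eulerian_poly (n - 1)) k
        = int (eulerian (n - 1) (int k - 1))"
      using assms by (intro coeff_X_mult_eulerian_poly) simp
    \<comment> \<open>Beyond degree \<open>n\<close> the type B and D polynomials are cut off by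
      definition, so the last summand has to vanish there as well.\<close>
    moreover have "eulerian (n - 1) (int k - 1) = 0" if "\<not> k \<le> n"
      using assms that by (intro eulerian_eq_0) auto
    ultimately show "coeff (eulerian_poly_B n) k = coeff (eulerian_poly_D n
              + smult (int n * 2 ^ (n - 1)) (monom 1 1 * eulerian_poly (n - 1))) k"
      by (auto simp: eq)
  qed
qed

end
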